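(* Let $\mathcal{T}$ be the set of real-valued time series of finite length, $\delta$ the dtw-distance on $\mathcal{T}$, $[x]=\{y\in\mathcal{T} : \delta(x,y)=0\}$ for $x\in\mathcal{T}$, and $\mathcal{T}^*=\{[x] : x\in\mathcal{T}\}$. Then the quotient distance $$\delta^*:\mathcal{T}^*\times\mathcal{T}^*\to\mathbb{R}_{\ge 0},\qquad ([x],[y])\mapsto \inf_{x'\in[x]}\ \inf_{y'\in[y]}\ \delta(x',y')$$ is a well-defined semi-metric on $\mathcal{T}^*$, and it satisfies $$\delta^*([x],[y])=\delta(x^*,y^* )$$ for all $x,y\in\mathcal{T}$, where $x^*$ and $y^*$ are the condensed forms of $x$ and $y$, respectively.
   Context: A (real-valued) time series is a finite sequence $x=(x_1,\dots,x_n)$ with $n\ge 1$ and $x_i\in\mathbb{R}$; its length is $|x|=n$. $\mathcal{T}$ is the set of all time series. A warping path of order $m\times n$ is a finite sequence $p=(p_1,\dots,p_\ell)$ of points $p_l=(i_l,j_l)\in\{1,\dots,m\}\times\{1,\dots,n\}$ with $p_1=(1,1)$, $p_\ell=(m,n)$ and $p_{l+1}-p_l\in\{(1,0),(0,1),(1,1)\}$ for $1\le l<\ell$. The dtw-distance of $x,y\in\mathcal{T}$ with $|x|=m$, $|y|=n$ is $\delta(x,y)=\min_p \big(\sum_{l=1}^{\ell}(x_{i_l}-y_{j_l})^2\big)^{1/2}$, the minimum being over all warping paths $p$ of order $m\times n$. Regard time series as words over the alphabet $\mathbb{R}$. For a word $v$ let $\mathcal{A}(v)$ be the set of elements occurring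 in $v$. A prime word is a word $a^n$ ($a$ repeated $n$ times) with $a\in\mathbb{R}$, $n\ge1$. The prime factorization of $x$ is the (unique) sequence of prime words $p_1,\dots,p_k$ whose concatenation is $x$ and with $\mathcal{A}(p_t)\ne\mathcal{A}(p_{t+1})$ for $1\le t<k$. A word $x$ with prime factorization $p_1,\dots,p_k$ is an expansion of a word $x'$ with prime factorization $p'_1,\dots,p'_{k'}$, written $x\succ x'$, if $k=k'$, $\mathcal{A}(p_t)=\mathcal{A}(p'_t)$ and $|p_t|\ge|p'_t|$ for all $t$. A word is irreducible if all its prime factors have length one. The condensed form $x^*$ of $x$ is the (unique) irreducible word with $x\succ x^*$. A semi-metric on a set $S$ is a function $d:S\times S\to\mathbb{R}_{\ge0}$ with $d(s,t)=d(t,s)$ and $d(s,t)=0\Leftrightarrow s=t$ for all $s,t\in S$ (the triangle inequality is not required). *)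

theory Defs
  imports Complex_Main "HOL-Library.Product_Plus"
begin

definition time_series :: "real list set" where
  "time_series = {x. x \<noteq> []}"

text \<open>Steps are stated additively because subtraction on \<^typ>\<open>nat\<close> truncates.\<close>

definition warping_path :: "nat \<Rightarrow> nat \<Rightarrow> (nat \<times> nat) list \<Rightarrow> bool" where
  "warping_path m n p \<longleftrightarrow>
     p \<noteq> [] \<and> set p \<subseteq> {1..m} \<times> {1..n} \<and> hd p = (1, 1) \<and> last p = (m, n) \<and>
     (\<forall>l. Suc l < length p \<longrightarrow>
        p ! Suc l \<in> {p ! l + (1, 0), p ! l + (0, 1), p ! l + (1, 1)})"

text \<open>Points of a warping path count positions from 1, list positions count from 0.\<close>

definition warping_cost :: "real list \<Rightarrow> real list \<Rightarrow> (nat \<times> nat) list \<Rightarrow> real" where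
  "warping_cost x y p = sqrt (\<Sum>(i, j)\<leftarrow>p. (x ! (i - 1) - y ! (j - 1))\<^sup>2)"

definition dtw :: "real list \<Rightarrow> real list \<Rightarrow> real" where
  "dtw x y = Min (warping_cost x y ` {p. warping_path (length x) (length y) p})"

definition prime_word :: "'a list \<Rightarrow> bool" where
  "prime_word w \<longleftrightarrow> (\<exists>a n. n \<ge> 1 \<and> w = replicate n a)"

definition is_word_factorization :: "'a list \<Rightarrow> 'a list list \<Rightarrow> bool" where
  "is_word_factorization x ps \<longleftrightarrow>
     concat ps = x \<and> (\<forall>p\<in>set ps. prime_word p) \<and>
     (\<forall>t. Suc t < length ps \<longrightarrow> set (ps ! t) \<noteq> set (ps ! Suc t))"

definition word_factorization :: "'a list \<Rightarrow> 'a list list" where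
  "word_factorization x = (THE ps. is_word_factorization x ps)"

definition expansion_of :: "'a list \<Rightarrow> 'a list \<Rightarrow> bool" (infix \<open>\<succ>\<close> 50) where
  "x \<succ> x' \<longleftrightarrow>
     (let ps = word_factorization x; ps' = word_factorization x' in
        length ps = length ps' \<and>
        (\<forall>t<length ps. set (ps ! t) = set (ps' ! t) \<and> length (ps ! t) \<ge> length (ps' ! t)))"

definition irreducible_word :: "'a list \<Rightarrow> bool" where
  "irreducible_word x \<longleftrightarrow> (\<forall>p\<in>set (word_factorization x). length p = 1)"

definition condensed :: "'a list \<Rightarrow> 'a list" where
  "condensed x = (THE x'. irreducible_word x' \<and> x \<succ> x')"

definition dtw_class :: "real list \<Rightarrow> real list set" where
  "dtw_class x = {y \<in> time_series. dtw x y = 0}"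

definition dtw_classes :: "real list set set" where
  "dtw_classes = dtw_class ` time_series"

definition dtw_quotient :: "real list set \<Rightarrow> real list set \<Rightarrow> real" where
  "dtw_quotient A B = (INF x\<in>A. INF y\<in>B. dtw x y)"

definition semi_metric_on :: "'s set \<Rightarrow> ('s \<Rightarrow> 's \<Rightarrow> real) \<Rightarrow> bool" where
  "semi_metric_on S d \<longleftrightarrow>
     (\<forall>s\<in>S. \<forall>t\<in>S. d s t \<ge> 0 \<and> d s t = d t s \<and> (d s t = 0 \<longleftrightarrow> s = t))"

text \<open>
  On \<^typ>\<open>real\<close>, the operator \<^const>\<open>Inf\<close> is total, so a formula with infima always denotes some
  number. The following predicate says that both nested infima of \<^const>\<open>dtw_quotient\<close> are genuine
  ones: they range over non-empty sets of reals that are bounded below.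
\<close>

definition dtw_quotient_well_defined :: "real list set \<Rightarrow> real list set \<Rightarrow> bool" where
  "dtw_quotient_well_defined A B \<longleftrightarrow>
     A \<noteq> {} \<and> B \<noteq> {} \<and>
     (\<forall>x\<in>A. bdd_below (dtw x ` B)) \<and>
     bdd_below ((\<lambda>x. INF y\<in>B. dtw x y) ` A)"

end

theory Submission
  imports Defs
begin

text \<open>
  The condensed form merges equal neighbours. Replacing each position of a warping path by the index
  of its block, and then merging repeated points, gives a warping path between the condensed forms
  whose cost is not larger. A warping path of cost zero between two condensed words can only move
  diagonally, so such words are equal. Hence every class contains exactly one condensed word, and
  the infima are attained at the condensed words.
\<close>

section \<open>Prime factorizations and condensed forms\<close>

lemma prime_word_iff: "prime_word p \<longleftrightarrow> p \<noteq> [] \<and> (\<forall>a\<in>set p. a = hd p)"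
proof
  assume "prime_word p"
  then show "p \<noteq> [] \<and> (\<forall>a\<in>set p. a = hd p)"
    by (auto simp: prime_word_def)
next
  assume *: "p \<noteq> [] \<and> (\<forall>a\<in>set p. a = hd p)"
  then have "replicate (length p) (hd p) = p"
    by (intro replicate_eqI[symmetric]) auto
  with * show "prime_word p"
    unfolding prime_word_def by (metis One_nat_def Suc_leI length_greater_0_conv)
qed

lemma set_prime_word: "prime_word p \<Longrightarrow> set p = {hd p}"
  by (auto simp: prime_word_iff)

text \<open>A prime word repeats one letter, so comparing the letter sets of neighbouring factors
  amounts to comparing their heads.\<close>

lemma is_word_factorization_iff:
  "is_word_factorization x ps \<longleftrightarrow>
     concat ps = x \<and> (\<forall>p\<in>set ps. prime_word p) \<and> distinct_adj (map hd ps)"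
proof -
  have "(\<forall>t. Suc t < length ps \<longrightarrow> set (ps ! t) \<noteq> set (ps ! Suc t)) \<longleftrightarrow> distinct_adj (map hd ps)"
    if "\<forall>p\<in>set ps. prime_word p"
    using that by (simp add: distinct_adj_conv_nth set_prime_word)
  then show ?thesis
    unfolding is_word_factorization_def by blast
qed

text \<open>The first factor is constant and the next one begins with another letter, so the first
  factor is the longest constant prefix. Peeling it off determines a factorization from its
  word.\<close>

lemma is_word_factorization_ConsD:
  assumes "is_word_factorization x (p # ps)"
  shows "x \<noteq> []" "p = takeWhile (\<lambda>b. b = hd x) x"
    "is_word_factorization (dropWhile (\<lambda>b. b = hd x) x) ps"
proof -
  have p: "p \<noteq> []" "\<forall>b\<in>set p. b = hd p" and x: "x = p @ concat ps"
    using assms by (auto simp: is_word_factorization_iff prime_word_iff)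
  have hd: "hd x = hd p" using x p by simp
  define ys where "ys = concat ps"
  \<comment> \<open>This makes \<open>takeWhile\<close> and \<open>dropWhile\<close> stop exactly at
    the end of \<open>p\<close>.\<close>
  have next_block: "ys = [] \<or> hd ys \<noteq> hd p"
    unfolding ys_def using assms
    by (cases ps) (auto simp: is_word_factorization_iff prime_word_iff)
  show "x \<noteq> []" using x p by simp
  have "takeWhile (\<lambda>b. b = hd x) x = p"
    unfolding hd unfolding x ys_def[symmetric] using p next_block
    by (cases ys) (auto simp: takeWhile_append2 takeWhile_eq_all_conv)
  then show "p = takeWhile (\<lambda>b. b = hd x) x" ..
  have "dropWhile (\<lambda>b. b = hd x) x = concat ps"
    unfolding hd unfolding x ys_def[symmetric] using p next_block
    by (cases ys) (auto simp: dropWhile_append2)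
  then show "is_word_factorization (dropWhile (\<lambda>b. b = hd x) x) ps"
    using assms by (auto simp: is_word_factorization_iff distinct_adj_Cons)
qed

lemma is_word_factorization_unique:
  "is_word_factorization x ps \<Longrightarrow> is_word_factorization x qs \<Longrightarrow> ps = qs"
proof (induction ps arbitrary: x qs)
  case Nil
  then show ?case
    by (cases qs) (auto simp: is_word_factorization_iff prime_word_iff)
next
  case (Cons p ps)
  note p = is_word_factorization_ConsD[OF Cons.prems(1)]
  obtain q qs' where qs: "qs = q # qs'"
    using Cons.prems(2) p(1) by (cases qs) (auto simp: is_word_factorization_iff)
  note q = is_word_factorization_ConsD[OF Cons.prems(2)[unfolded qs]]
  show ?case
    using p q Cons.IH qs by metis
qed

text \<open>A letter put in front either lengthens the first factor or opens a factor of its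
  own.\<close>

lemma is_word_factorization_exists: "\<exists>ps. is_word_factorization x ps"
proof (induction x)
  case Nil
  show ?case by (rule exI[of _ "[]"]) (simp add: is_word_factorization_iff)
next
  case (Cons a x)
  then obtain ps where ps: "is_word_factorization x ps" by blast
  show ?case
  proof (cases "ps \<noteq> [] \<and> hd (hd ps) = a")
    case True
    then obtain p qs where p: "ps = p # qs" "hd p = a" by (cases ps) auto
    have "is_word_factorization (a # x) ((a # p) # qs)"
      using ps p by (auto simp: is_word_factorization_iff prime_word_iff distinct_adj_Cons)
    then show ?thesis ..
  next
    case False
    then have "is_word_factorization (a # x) ([a] # ps)"
      using ps by (auto simp: is_word_factorization_iff prime_word_iff distinct_adj_Cons hd_map)
    then show ?thesis ..
  qed
qed

lemma word_factorization_eq: "is_word_factorization x ps \<Longrightarrow> word_factorization x = ps"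
  unfolding word_factorization_def by (blast intro: is_word_factorization_unique)

lemma is_word_factorization: "is_word_factorization x (word_factorization x)"
  using is_word_factorization_exists word_factorization_eq by metis

text \<open>Both sides arise by repeatedly replacing the longest constant prefix by its letter. This
  links the factorization to \<open>remdups_adj\<close>.\<close>

lemma map_hd_word_factorization: "map hd (word_factorization x) = remdups_adj x"
proof -
  have "map hd ps = remdups_adj x" if "is_word_factorization x ps" for ps
    using that
  proof (induction ps arbitrary: x)
    case Nil
    then show ?case by (simp add: is_word_factorization_iff)
  next
    case (Cons p ps)
    note p = is_word_factorization_ConsD[OF Cons.prems]
    obtain a x' where x: "x = a # x'" using p(1) by (cases x) auto
    show ?case
      using Cons.IH[OF p(3)] p(2) by (simp add: x remdups_adj_Cons')
  qed
  then show ?thesis using is_word_factorization by blast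
qed

lemma word_factorization_distinct_adj:
  "distinct_adj x \<Longrightarrow> word_factorization x = map (\<lambda>a. [a]) x"
  by (rule word_factorization_eq)
    (auto simp: is_word_factorization_iff prime_word_iff comp_def)

lemma irreducible_word_iff: "irreducible_word x \<longleftrightarrow> distinct_adj x"
proof
  assume irr: "irreducible_word x"
  have "x = concat (word_factorization x)"
    using is_word_factorization[of x] by (simp add: is_word_factorization_iff)
  \<comment> \<open>A factor of length one is \<open>[hd p]\<close>, so the word coincides with its
    list of heads.\<close>
  also have "\<dots> = concat (map (\<lambda>p. [hd p]) (word_factorization x))"
    using irr unfolding irreducible_word_def
    by (intro arg_cong[of _ _ concat] map_idI[symmetric]) (auto simp: length_Suc_conv)
  also have "\<dots> = remdups_adj x"
    by (simp flip: map_hd_word_factorization)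
  finally show "distinct_adj x"
    by (metis distinct_adj_remdups_adj)
next
  assume "distinct_adj x"
  then show "irreducible_word x"
    by (simp add: irreducible_word_def word_factorization_distinct_adj)
qed

text \<open>Corresponding factors have the same singleton letter set, hence the same head.\<close>

lemma expansion_of_imp_remdups_adj_eq:
  assumes "x \<succ> x'"
  shows "remdups_adj x = remdups_adj x'"
proof -
  have "prime_word p" if "p \<in> set (word_factorization z)" for p z :: "'a list"
    using that is_word_factorization[of z] by (simp add: is_word_factorization_iff)
  then have "map hd (word_factorization x) = map hd (word_factorization x')"
    using assms unfolding expansion_of_def Let_def
    by (intro nth_equalityI) (auto, metis nth_mem set_prime_word singleton_inject)
  then show ?thesis by (simp add: map_hd_word_factorization)
qed

lemma expansion_of_remdups_adj: "x \<succ> remdups_adj x"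
proof -
  have "word_factorization (remdups_adj x) = map (\<lambda>a. [a]) (remdups_adj x)"
    by (simp add: word_factorization_distinct_adj)
  also have "\<dots> = map (\<lambda>p. [hd p]) (word_factorization x)"
    by (simp flip: map_hd_word_factorization)
  finally have wf: "word_factorization (remdups_adj x) = map (\<lambda>p. [hd p]) (word_factorization x)" .
  have "prime_word p" if "p \<in> set (word_factorization x)" for p
    using that is_word_factorization[of x] by (simp add: is_word_factorization_iff)
  then have "set p = {hd p} \<and> 1 \<le> length p" if "p \<in> set (word_factorization x)" for p
    using that set_prime_word by (metis One_nat_def Suc_leI length_greater_0_conv prime_word_iff)
  then show ?thesis
    unfolding expansion_of_def Let_def wf by simp
qed

text \<open>Any irreducible \<open>x'\<close> with \<open>x \<succ> x'\<close> is its own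
  \<open>remdups_adj\<close>, which equals that of \<open>x\<close>; this gives the uniqueness
  behind \<open>THE\<close>.\<close>

lemma condensed_eq: "condensed x = remdups_adj x"
  unfolding condensed_def
proof (rule the_equality)
  show "irreducible_word (remdups_adj x) \<and> x \<succ> remdups_adj x"
    by (simp add: irreducible_word_iff expansion_of_remdups_adj)
next
  fix x' assume "irreducible_word x' \<and> x \<succ> x'"
  then show "x' = remdups_adj x"
    using expansion_of_imp_remdups_adj_eq[of x x'] by (simp add: irreducible_word_iff distinct_adj_altdef)
qed

section \<open>Warping paths\<close>

text \<open>A relation, so that the step condition on paths becomes an instance of
  \<open>successively\<close>.\<close>

definition warping_step :: "nat \<times> nat \<Rightarrow> nat \<times> nat \<Rightarrow> bool" where
  "warping_step q r \<longleftrightarrow> r \<in> {q + (1, 0), q + (0, 1), q + (1, 1)}"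

lemma warping_path_iff:
  "warping_path m n p \<longleftrightarrow>
     p \<noteq> [] \<and> set p \<subseteq> {1..m} \<times> {1..n} \<and> hd p = (1, 1) \<and> last p = (m, n) \<and>
     successively warping_step p"
  unfolding warping_path_def warping_step_def successively_conv_nth by simp

lemma warping_path_pos:
  assumes "warping_path m n p"
  shows "1 \<le> m" "1 \<le> n"
  using assms last_in_set[of p] by (auto simp: warping_path_iff)

lemma warping_path_snoc:
  assumes "warping_path i j p" "warping_step (i, j) (m, n)"
  shows "warping_path m n (p @ [(m, n)])"
  using assms warping_path_pos[OF assms(1)]
  by (auto simp: warping_path_iff successively_append_iff warping_step_def)

text \<open>The coordinate sum starts at 2, grows by at least one per step and ends at
  \<open>m + n\<close>. The bound serves to show that there are only finitely many paths.\<close>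

lemma warping_path_length:
  assumes "warping_path m n p"
  shows "length p \<le> m + n"
proof -
  have "t + 2 \<le> fst (p ! t) + snd (p ! t)" if "t < length p" for t
    using that
  proof (induction t)
    case 0
    then show ?case using assms by (simp add: warping_path_iff hd_conv_nth)
  next
    case (Suc t)
    have "warping_step (p ! t) (p ! Suc t)"
      using assms Suc.prems by (simp add: warping_path_iff successively_nth)
    then show ?case using Suc by (auto simp: warping_step_def)
  qed
  from this[of "length p - 1"] show ?thesis
    using assms by (auto simp: warping_path_iff last_conv_nth)
qed

lemma finite_warping_paths: "finite {p. warping_path m n p}"
proof (rule finite_subset)
  show "{p. warping_path m n p} \<subseteq> {p. set p \<subseteq> {1..m} \<times> {1..n} \<and> length p \<le> m + n}"
    using warping_path_length by (auto simp: warping_path_iff)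
  show "finite {p. set p \<subseteq> {1..m} \<times> {1..n} \<and> length p \<le> m + n}"
    by (intro finite_lists_length_le) simp
qed

lemma warping_path_1_1: "warping_path 1 1 [(1, 1)]"
  by (simp add: warping_path_iff)

lemma warping_path_exists:
  assumes "1 \<le> m" "1 \<le> n"
  shows "\<exists>p. warping_path m n p"
  using assms(2)
\<comment> \<open>The path first runs along the first coordinate to \<open>(m, 1)\<close>, then
  along the second one.\<close>
proof (induction n rule: dec_induct)
  case base
  show ?case using assms(1)
  proof (induction m rule: dec_induct)
    case base
    show ?case using warping_path_1_1 ..
  next
    case (step m)
    then show ?case
      using warping_path_snoc[of m 1 _ "Suc m" 1] by (auto simp: warping_step_def)
  qed
next
  case (step n)
  then show ?case
    using warping_path_snoc[of m n _ m "Suc n"] by (auto simp: warping_step_def)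
qed

lemma warping_path_swap:
  assumes "warping_path m n p"
  shows "warping_path n m (map prod.swap p)"
  using assms unfolding warping_path_iff successively_map
  by (auto simp: hd_map last_map warping_step_def elim!: successively_mono)

section \<open>The dtw-distance\<close>

lemma dtw_le: "warping_path (length x) (length y) p \<Longrightarrow> dtw x y \<le> warping_cost x y p"
  unfolding dtw_def by (intro Min_le) (auto intro: finite_warping_paths)

text \<open>For non-empty series, \<open>Min\<close> in \<open>dtw\<close> ranges over a finite
  non-empty set, so some path is optimal.\<close>

lemma dtw_attained:
  assumes "x \<noteq> []" "y \<noteq> []"
  obtains p where "warping_path (length x) (length y) p" "dtw x y = warping_cost x y p"
proof -
  have "\<exists>p. warping_path (length x) (length y) p"
    using assms by (intro warping_path_exists) (simp_all add: Suc_le_eq)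
  then have "dtw x y \<in> warping_cost x y ` {p. warping_path (length x) (length y) p}"
    unfolding dtw_def by (intro Min_in) (auto intro: finite_warping_paths)
  then show thesis using that by auto
qed

lemma warping_cost_nonneg: "0 \<le> warping_cost x y p"
  unfolding warping_cost_def by (auto intro!: real_sqrt_ge_zero sum_list_nonneg)

lemma warping_cost_eq_0_iff:
  "warping_cost x y p = 0 \<longleftrightarrow> (\<forall>(i, j)\<in>set p. x ! (i - 1) = y ! (j - 1))"
  unfolding warping_cost_def real_sqrt_eq_0_iff
  by (subst sum_list_nonneg_eq_0_iff) auto

lemma warping_cost_swap: "warping_cost y x (map prod.swap p) = warping_cost x y p"
  unfolding warping_cost_def by (simp add: comp_def case_prod_unfold power2_commute)

lemma dtw_nonneg: "x \<noteq> [] \<Longrightarrow> y \<noteq> [] \<Longrightarrow> 0 \<le> dtw x y"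
  by (metis dtw_attained warping_cost_nonneg)

lemma dtw_commute:
  assumes "x \<noteq> []" "y \<noteq> []"
  shows "dtw x y = dtw y x"
proof (rule antisym)
  show "dtw x y \<le> dtw y x"
    by (metis assms dtw_attained dtw_le warping_cost_swap warping_path_swap)
  show "dtw y x \<le> dtw x y"
    by (metis assms dtw_attained dtw_le warping_cost_swap warping_path_swap)
qed

section \<open>Passing to condensed forms\<close>

text \<open>Positions are counted from 1, as in warping paths.\<close>

definition block_index :: "'a list \<Rightarrow> nat \<Rightarrow> nat" where
  "block_index x i = length (remdups_adj (take i x))"

lemma block_index_1: "x \<noteq> [] \<Longrightarrow> block_index x 1 = 1"
  by (cases x) (simp_all add: block_index_def)

lemma block_index_length: "block_index x (length x) = length (remdups_adj x)"
  by (simp add: block_index_def)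

lemma block_index_pos: "1 \<le> i \<Longrightarrow> i \<le> length x \<Longrightarrow> 1 \<le> block_index x i"
  by (auto simp: block_index_def Suc_le_eq)

text \<open>Letters appended to a non-empty prefix extend its condensed form only at the end, so
  counting blocks in prefixes gives valid positions in the condensed form of the whole word.\<close>

lemma remdups_adj_split:
  assumes "1 \<le> i" "i \<le> length x"
  obtains zs where "remdups_adj x = remdups_adj (take i x) @ zs"
proof -
  have "take i x \<noteq> []" using assms by auto
  from remdups_adj_append''[OF this, of "drop i x"] show thesis
    using that by simp
qed

lemma block_index_le:
  assumes "1 \<le> i" "i \<le> length x"
  shows "block_index x i \<le> length (remdups_adj x)"
proof -
  obtain zs where "remdups_adj x = remdups_adj (take i x) @ zs"
    using remdups_adj_split[OF assms] .
  then show ?thesis by (simp add: block_index_def)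
qed

text \<open>The condensed prefix of length \<open>i\<close> ends with the letter at position
  \<open>i\<close>. Thus moving to block indices keeps the compared letters.\<close>

lemma nth_block_index:
  assumes "1 \<le> i" "i \<le> length x"
  shows "remdups_adj x ! (block_index x i - 1) = x ! (i - 1)"
proof -
  obtain zs where "remdups_adj x = remdups_adj (take i x) @ zs"
    using remdups_adj_split[OF assms] .
  moreover have ne: "take i x \<noteq> []" using assms by auto
  ultimately have "remdups_adj x ! (block_index x i - 1) =
      remdups_adj (take i x) ! (length (remdups_adj (take i x)) - 1)"
    by (simp add: block_index_def nth_append)
  also have "\<dots> = last (take i x)"
    using ne by (metis last_conv_nth last_remdups_adj remdups_adj_Nil_iff)
  also have "\<dots> = x ! (i - 1)"
    using ne assms by (simp add: last_conv_nth)
  finally show ?thesis .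
qed

text \<open>One more letter either continues the current block or opens the next one.\<close>

lemma block_index_Suc:
  assumes "1 \<le> i" "i < length x"
  shows "block_index x (Suc i) = block_index x i \<or> block_index x (Suc i) = Suc (block_index x i)"
proof -
  have "take i x \<noteq> []" using assms by auto
  then show ?thesis
    using assms by (simp add: block_index_def take_Suc_conv_app_nth remdups_adj_append'')
qed

lemma sum_list_remdups_adj_le:
  fixes f :: "'a \<Rightarrow> real"
  assumes "\<And>a. 0 \<le> f a"
  shows "sum_list (map f (remdups_adj xs)) \<le> sum_list (map f xs)"
proof (induction xs rule: remdups_adj.induct)
  case (3 a b xs)
  then show ?case using assms[of a] by (cases "a = b") auto
qed simp_all

lemma dtw_remdups_adj_le:
  assumes "x \<noteq> []" "y \<noteq> []"
  shows "dtw (remdups_adj x) (remdups_adj y) \<le> dtw x y"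
proof -
  let ?f = "block_index x" and ?g = "block_index y"
  obtain p where p: "warping_path (length x) (length y) p" and cost: "dtw x y = warping_cost x y p"
    using dtw_attained[OF assms] .
  have sub: "1 \<le> i \<and> i \<le> length x \<and> 1 \<le> j \<and> j \<le> length y" if "(i, j) \<in> set p" for i j
    using p that by (auto simp: warping_path_iff)
  have ne: "p \<noteq> []" and succ: "successively warping_step p"
    using p by (auto simp: warping_path_iff)
  define q where "q = map (map_prod ?f ?g) p"
  \<comment> \<open>Each block index stays or grows by one along a step of \<open>p\<close>, so a
    step becomes a step or a standstill. Merging equal neighbours removes the standstills.\<close>
  have "successively (\<lambda>a b. a = b \<or> warping_step a b) q"
    unfolding q_def successively_map
  proof (rule successively_mono[OF succ])
    fix a b assume ab: "a \<in> set p" "b \<in> set p" "warping_step a b"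
    obtain i j i' j' where "a = (i, j)" "b = (i', j')" by (metis surj_pair)
    then show "map_prod ?f ?g a = map_prod ?f ?g b \<or>
        warping_step (map_prod ?f ?g a) (map_prod ?f ?g b)"
      using ab sub[of i j] sub[of i' j'] block_index_Suc[of i x] block_index_Suc[of j y]
      by (auto simp: warping_step_def)
  qed
  then have "successively (\<lambda>a b. a = b \<or> warping_step a b) (remdups_adj q)"
    by (rule successively_remdups_adjI)
  then have succ_q: "successively warping_step (remdups_adj q)"
    using remdups_adj_adjacent[of _ q] by (auto simp: successively_conv_nth)
  have "set q \<subseteq> {1..length (remdups_adj x)} \<times> {1..length (remdups_adj y)}"
  proof
    fix c assume "c \<in> set q"
    then obtain i j where "(i, j) \<in> set p" "c = (?f i, ?g j)" by (auto simp: q_def)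
    then show "c \<in> {1..length (remdups_adj x)} \<times> {1..length (remdups_adj y)}"
      using sub[of i j] block_index_pos[of i x] block_index_pos[of j y]
        block_index_le[of i x] block_index_le[of j y] by simp
  qed
  moreover have "q \<noteq> []" "hd q = (1, 1)" "last q = (length (remdups_adj x), length (remdups_adj y))"
    using p assms
    by (simp_all add: warping_path_iff q_def hd_map last_map block_index_length
        block_index_1[simplified])
  ultimately have
    "warping_path (length (remdups_adj x)) (length (remdups_adj y)) (remdups_adj q)"
    using succ_q by (simp add: warping_path_iff)
  then have "dtw (remdups_adj x) (remdups_adj y) \<le>
      warping_cost (remdups_adj x) (remdups_adj y) (remdups_adj q)"
    by (rule dtw_le)
  also have "\<dots> \<le> warping_cost (remdups_adj x) (remdups_adj y) q"
    unfolding warping_cost_def by (intro real_sqrt_le_mono sum_list_remdups_adj_le) auto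
  \<comment> \<open>Block indices point to the same letters, so the cost is unchanged here; only the
    merging can lower it.\<close>
  also have "\<dots> = warping_cost x y p"
    unfolding warping_cost_def q_def map_map
    using sub
    by (intro arg_cong[of _ _ sqrt] arg_cong[of _ _ sum_list] map_cong)
      (auto simp: nth_block_index[simplified] dest: sub)
  finally show ?thesis using cost by simp
qed

section \<open>Series at distance zero\<close>

lemma dtw_eq_0_imp_eq:
  assumes "x \<noteq> []" "y \<noteq> []" "distinct_adj x" "distinct_adj y" "dtw x y = 0"
  shows "x = y"
proof -
  obtain p where p: "warping_path (length x) (length y) p" and "warping_cost x y p = 0"
    using dtw_attained[OF assms(1,2)] assms(5) by metis
  then have eq: "x ! (fst r - 1) = y ! (snd r - 1)" if "r \<in> set p" for r
    using that by (auto simp: warping_cost_eq_0_iff)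
  have sub: "set p \<subseteq> {1..length x} \<times> {1..length y}" using p by (simp add: warping_path_iff)
  \<comment> \<open>Cost zero means that matched letters agree, so a step in only one coordinate
    would force two equal neighbours in a condensed word. The list index \<open>t\<close> counts
    from 0, the coordinates from 1.\<close>
  have diag: "p ! t = (Suc t, Suc t)" if "t < length p" for t
    using that
  proof (induction t)
    case 0
    then show ?case using p by (simp add: warping_path_iff hd_conv_nth)
  next
    case (Suc t)
    have IH: "p ! t = (Suc t, Suc t)" using Suc by simp
    have mem: "p ! t \<in> set p" "p ! Suc t \<in> set p" using Suc.prems by simp_all
    have "warping_step (p ! t) (p ! Suc t)"
      using p Suc.prems by (simp add: warping_path_iff successively_nth)
    then consider "p ! Suc t = (Suc (Suc t), Suc t)" | "p ! Suc t = (Suc t, Suc (Suc t))"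
      | "p ! Suc t = (Suc (Suc t), Suc (Suc t))"
      by (auto simp: warping_step_def IH)
    then show ?case
    proof cases
      \<comment> \<open>Here \<open>x ! t\<close> and \<open>x ! Suc t\<close> both equal
        \<open>y ! t\<close>. Case 2 is the mirror image, and the diagonal case is the claim
        itself.\<close>
      case 1
      then show ?thesis
        using eq[OF mem(1)] eq[OF mem(2)] IH sub mem distinct_adj_nth[OF assms(3), of t] by auto
    next
      case 2
      then show ?thesis
        using eq[OF mem(1)] eq[OF mem(2)] IH sub mem distinct_adj_nth[OF assms(4), of t] by auto
    qed
  qed
  have "p \<noteq> []" using p by (simp add: warping_path_iff)
  \<comment> \<open>The end point also is \<open>(length x, length y)\<close>, which makes the two
    lengths equal.\<close>
  then have "last p = (length p, length p)"
    using diag[of "length p - 1"] by (simp add: last_conv_nth)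
  then have len: "length x = length p" "length y = length p"
    using p by (simp_all add: warping_path_iff)
  show ?thesis
  proof (rule nth_equalityI)
    show "length x = length y" using len by simp
    show "x ! t = y ! t" if "t < length x" for t
      using that eq[OF nth_mem, of t] diag[of t] len by simp
  qed
qed

text \<open>A path of cost zero is traced back from the end, keeping both positions in blocks of the
  same index. As the condensed forms agree, such positions carry the same letter.\<close>

lemma dtw_eq_0_if_remdups_adj_eq:
  assumes "x \<noteq> []" "y \<noteq> []" and eq: "remdups_adj x = remdups_adj y"
  shows "dtw x y = 0"
proof -
  have "\<exists>p. warping_path m n p \<and> (\<forall>(i, j)\<in>set p. x ! (i - 1) = y ! (j - 1))"
    if "1 \<le> m" "m \<le> length x" "1 \<le> n" "n \<le> length y" "block_index x m = block_index y n" for m n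
    using that
  proof (induction "m + n" arbitrary: m n rule: less_induct)
    case less
    have same: "x ! (m - 1) = y ! (n - 1)"
      using less.prems nth_block_index[of m x] nth_block_index[of n y] eq by simp
    have extend: ?case
      if smaller: "1 \<le> i" "i \<le> m" "1 \<le> j" "j \<le> n" "warping_step (i, j) (m, n)"
        "block_index x i = block_index y j" for i j
    proof -
      have "i + j < m + n" using smaller by (auto simp: warping_step_def)
      then obtain p where "warping_path i j p" "\<forall>(i, j)\<in>set p. x ! (i - 1) = y ! (j - 1)"
        using less.hyps[of i j] less.prems smaller by auto
      then show ?thesis
        using warping_path_snoc[of i j p m n] smaller same by (intro exI[of _ "p @ [(m, n)]"]) auto
    qed
    have x_pred: "block_index x (m - 1) = block_index x m \<or> Suc (block_index x (m - 1)) = block_index x m"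
      if "1 < m"
      using block_index_Suc[of "m - 1" x] that less.prems by auto
    have y_pred: "block_index y (n - 1) = block_index y n \<or> Suc (block_index y (n - 1)) = block_index y n"
      if "1 < n"
      using block_index_Suc[of "n - 1" y] that less.prems by auto
    have pos: "1 < m \<Longrightarrow> 1 \<le> block_index x (m - 1)" "1 < n \<Longrightarrow> 1 \<le> block_index y (n - 1)"
      by (rule block_index_pos; use less.prems in linarith)+
    \<comment> \<open>If one position can move back within its block, it does so alone. Otherwise
      both open their blocks and move back together, so that both indices drop by one. Since indices
      are at least 1, this cannot happen when just one position has reached 1.\<close>
    consider "m = 1" "n = 1"
      | "1 < m" "block_index x (m - 1) = block_index x m"
      | "1 < n" "block_index y (n - 1) = block_index y n"
      | "1 < m" "1 < n" "block_index x (m - 1) = block_index y (n - 1)"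
      using x_pred y_pred pos less.prems assms block_index_1[of x] block_index_1[of y]
      by (cases "m = 1"; cases "n = 1") auto
    then show ?case
    proof cases
      case 1
      then show ?thesis using warping_path_1_1 same by (intro exI[of _ "[(1, 1)]"]) auto
    next
      case 2
      then show ?thesis using less.prems by (intro extend[of "m - 1" n]) (auto simp: warping_step_def)
    next
      case 3
      then show ?thesis using less.prems by (intro extend[of m "n - 1"]) (auto simp: warping_step_def)
    next
      case 4
      then show ?thesis
        using less.prems by (intro extend[of "m - 1" "n - 1"]) (auto simp: warping_step_def)
    qed
  qed
  from this[of "length x" "length y"] obtain p where
    "warping_path (length x) (length y) p" "warping_cost x y p = 0"
    using assms by (auto simp: block_index_length Suc_le_eq warping_cost_eq_0_iff)
  then show ?thesis
    using dtw_le[of x y p] dtw_nonneg[OF assms(1,2)] by simp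
qed

text \<open>Condensing does not raise the distance, so distance zero passes to the condensed forms,
  which then coincide. Distance zero is thus an equivalence relation, without appeal to a triangle
  inequality.\<close>

lemma dtw_eq_0_iff:
  assumes "x \<noteq> []" "y \<noteq> []"
  shows "dtw x y = 0 \<longleftrightarrow> remdups_adj x = remdups_adj y"
proof
  assume "dtw x y = 0"
  then have "dtw (remdups_adj x) (remdups_adj y) = 0"
    using dtw_remdups_adj_le[OF assms] dtw_nonneg[of "remdups_adj x" "remdups_adj y"] assms by simp
  then show "remdups_adj x = remdups_adj y"
    using assms by (intro dtw_eq_0_imp_eq) auto
qed (rule dtw_eq_0_if_remdups_adj_eq[OF assms])

section \<open>The quotient distance\<close>

lemma dtw_class_eq:
  "x \<noteq> [] \<Longrightarrow> dtw_class x = {y. y \<noteq> [] \<and> remdups_adj y = remdups_adj x}"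
  by (auto simp: dtw_class_def time_series_def dtw_eq_0_iff)

lemma dtw_class_eq_iff:
  "x \<noteq> [] \<Longrightarrow> y \<noteq> [] \<Longrightarrow> dtw_class x = dtw_class y \<longleftrightarrow> remdups_adj x = remdups_adj y"
  by (auto simp: dtw_class_eq)

text \<open>Condensing twice changes nothing. This member of the class attains the infima.\<close>

lemma remdups_adj_in_dtw_class: "x \<noteq> [] \<Longrightarrow> remdups_adj x \<in> dtw_class x"
  using distinct_adj_remdups_adj[of x] by (simp add: dtw_class_eq distinct_adj_altdef)

lemma bdd_below_dtw:
  assumes "x \<noteq> []" "y \<noteq> []"
  shows "bdd_below (dtw x ` dtw_class y)"
  using assms by (intro bdd_belowI[of _ 0]) (auto simp: dtw_class_eq dtw_nonneg)

text \<open>All members of a class condense to the same word, so one lower bound serves all pairs.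
  It yields both the boundedness of the outer infimum and the lower estimate of the quotient
  distance.\<close>

lemma INF_dtw_class_ge:
  assumes "x \<noteq> []" "y \<noteq> []" "x' \<in> dtw_class x"
  shows "dtw (remdups_adj x) (remdups_adj y) \<le> (INF y'\<in>dtw_class y. dtw x' y')"
proof (rule cINF_greatest)
  show "dtw_class y \<noteq> {}" using remdups_adj_in_dtw_class assms(2) by blast
  show "dtw (remdups_adj x) (remdups_adj y) \<le> dtw x' y'" if "y' \<in> dtw_class y" for y'
    using that assms dtw_remdups_adj_le[of x' y'] by (auto simp: dtw_class_eq)
qed

lemma bdd_below_INF_dtw:
  assumes "x \<noteq> []" "y \<noteq> []"
  shows "bdd_below ((\<lambda>x'. INF y'\<in>dtw_class y. dtw x' y') ` dtw_class x)"
  using INF_dtw_class_ge[OF assms] by (auto intro!: bdd_belowI)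

lemma dtw_quotient_well_defined_dtw_class:
  assumes "x \<noteq> []" "y \<noteq> []"
  shows "dtw_quotient_well_defined (dtw_class x) (dtw_class y)"
  unfolding dtw_quotient_well_defined_def
proof (intro conjI ballI)
  show "dtw_class x \<noteq> {}" "dtw_class y \<noteq> {}"
    using assms[THEN remdups_adj_in_dtw_class] by auto
  show "bdd_below (dtw x' ` dtw_class y)" if "x' \<in> dtw_class x" for x'
    using that assms by (intro bdd_below_dtw) (simp_all add: dtw_class_eq)
qed (rule bdd_below_INF_dtw[OF assms])

lemma dtw_quotient_dtw_class:
  assumes "x \<noteq> []" "y \<noteq> []"
  shows "dtw_quotient (dtw_class x) (dtw_class y) = dtw (remdups_adj x) (remdups_adj y)"
  unfolding dtw_quotient_def
proof (rule antisym)
  note mem = remdups_adj_in_dtw_class[OF assms(1)] remdups_adj_in_dtw_class[OF assms(2)]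
  \<comment> \<open>The upper estimate evaluates the outer and then the inner infimum at the
    condensed words.\<close>
  have "(INF x'\<in>dtw_class x. INF y'\<in>dtw_class y. dtw x' y')
      \<le> (INF y'\<in>dtw_class y. dtw (remdups_adj x) y')"
    using bdd_below_INF_dtw[OF assms] mem(1) by (rule cINF_lower)
  also have "\<dots> \<le> dtw (remdups_adj x) (remdups_adj y)"
    using mem(2) assms by (intro cINF_lower bdd_below_dtw) auto
  finally show "(INF x'\<in>dtw_class x. INF y'\<in>dtw_class y. dtw x' y')
      \<le> dtw (remdups_adj x) (remdups_adj y)" .
  show "dtw (remdups_adj x) (remdups_adj y)
      \<le> (INF x'\<in>dtw_class x. INF y'\<in>dtw_class y. dtw x' y')"
    using mem(1) by (intro cINF_greatest INF_dtw_class_ge assms) auto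
qed

theorem theorem28:
  shows "(\<forall>A\<in>dtw_classes. \<forall>B\<in>dtw_classes. dtw_quotient_well_defined A B) \<and>
         semi_metric_on dtw_classes dtw_quotient \<and>
         (\<forall>x\<in>time_series. \<forall>y\<in>time_series.
            dtw_quotient (dtw_class x) (dtw_class y) = dtw (condensed x) (condensed y))"
proof (intro conjI)
  show "\<forall>A\<in>dtw_classes. \<forall>B\<in>dtw_classes. dtw_quotient_well_defined A B"
    by (auto simp: dtw_classes_def time_series_def dtw_quotient_well_defined_dtw_class)
  \<comment> \<open>All three laws reduce to \<open>dtw\<close> on condensed words. Idempotence of
    \<open>remdups_adj\<close> turns distance zero there into equality of the condensed forms, that
    is, of the classes.\<close>
  have "0 \<le> dtw_quotient (dtw_class x) (dtw_class y) \<and>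
      dtw_quotient (dtw_class x) (dtw_class y) = dtw_quotient (dtw_class y) (dtw_class x) \<and>
      (dtw_quotient (dtw_class x) (dtw_class y) = 0 \<longleftrightarrow> dtw_class x = dtw_class y)"
    if "x \<noteq> []" "y \<noteq> []" for x y
    using that
    by (auto simp: distinct_adj_remdups_adj[unfolded distinct_adj_altdef] dtw_quotient_dtw_class dtw_class_eq_iff dtw_nonneg dtw_eq_0_iff
        dtw_commute[of "remdups_adj x" "remdups_adj y"])
  then show "semi_metric_on dtw_classes dtw_quotient"
    by (auto simp: semi_metric_on_def dtw_classes_def time_series_def)
  show "\<forall>x\<in>time_series. \<forall>y\<in>time_series.
      dtw_quotient (dtw_class x) (dtw_class y) = dtw (condensed x) (condensed y)"
    by (simp add: time_series_def condensed_eq dtw_quotient_dtw_class)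
qed

end
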